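(* For every hyperbolic polynomial $P$ of degree $n \ge 1$, every $\theta \in \mathbb{R}$ and every $h > 0$, we have $$\lambda(T_{\theta,h}(P)) \le \lambda(P) + h \cdot \lambda(Q_n) \quad \text{and} \quad \mu(T_{\theta,h}(P)) \ge \mu(P) + h \cdot \mu(Q_n),$$ where $$T_{\theta,h}(P)(x) = \frac{e^{i\theta} P(x+ih) - e^{-i\theta} P(x-ih)}{i}, \qquad Q_n(x) = Q_n(x,\theta) = T_{\theta,1}(x^n) = \frac{e^{i\theta}(x+i)^n - e^{-i\theta}(x-i)^n}{i}.$$
   Context: A real polynomial is called hyperbolic if all its zeros are real or if it is identically zero. For a hyperbolic polynomial $R$, $\lambda(R)$ denotes its maximal root and $\mu(R)$ its minimal root. The operator $T_{\theta,h}$ maps hyperbolic polynomials to hyperbolic polynomials. All zeros of $Q_n(x,\theta)$ are real and simple: if $\sin\theta \neq 0$, they are $\cot\frac{-\theta+\pi k}{n}$, $k = 1, \dots, n$; if $\sin\theta = 0$, they are $\cot\frac{\pi k}{n}$, $k = 1, \dots, n-1$. *)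

theory Defs
  imports "HOL-Analysis.Analysis" "HOL-Computational_Algebra.Polynomial"
begin

definition hyperbolic :: "real poly \<Rightarrow> bool" where
  "hyperbolic R \<longleftrightarrow> R = 0 \<or> (\<forall>z. poly (map_poly complex_of_real R) z = 0 \<longrightarrow> z \<in> \<real>)"

text \<open>
  A nonzero constant polynomial has no zeros, so its maximal (minimal) root is by convention
  \<open>-\<infinity>\<close> (\<open>\<infinity>\<close>), the supremum (infimum) of the empty set; this is the only reason for extended
  real values. It matters for \<open>Q_poly 1 \<theta>\<close> with \<open>sin \<theta> = 0\<close>, which is constant. A hyperbolic
  polynomial of positive degree has finitely many, and at least one, real zeros. The zero
  polynomial has no extremal root, and its values here are junk.
\<close>

definition max_root :: "real poly \<Rightarrow> ereal" where
  "max_root R = (if degree R = 0 then -\<infinity> else ereal (Max {x. poly R x = 0}))"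

definition min_root :: "real poly \<Rightarrow> ereal" where
  "min_root R = (if degree R = 0 then \<infinity> else ereal (Min {x. poly R x = 0}))"

definition T_complex :: "real \<Rightarrow> real \<Rightarrow> real poly \<Rightarrow> complex poly" where
  "T_complex \<theta> h P =
     smult (1 / \<i>)
       (smult (exp (\<i> * of_real \<theta>)) (pcompose (map_poly of_real P) [:\<i> * of_real h, 1:])
        - smult (exp (- \<i> * of_real \<theta>)) (pcompose (map_poly of_real P) [:- \<i> * of_real h, 1:]))"

text \<open>
  The coefficients of \<open>T_complex \<theta> h P\<close> are real (\<open>T_op_complex\<close> below), so taking real parts
  only changes the type.
\<close>

definition T_op :: "real \<Rightarrow> real \<Rightarrow> real poly \<Rightarrow> real poly" where
  "T_op \<theta> h P = map_poly Re (T_complex \<theta> h P)"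

definition Q_poly :: "nat \<Rightarrow> real \<Rightarrow> real poly" where
  "Q_poly n \<theta> = T_op \<theta> 1 (monom 1 n)"

lemma map_poly_cnj_pcompose:
  "map_poly cnj (pcompose p q) = pcompose (map_poly cnj p) (map_poly cnj q)"
proof (induction p)
  case 0
  then show ?case by simp
next
  case (pCons a p)
  have add: "map_poly cnj (u + v) = map_poly cnj u + map_poly cnj v" for u v
    by (intro poly_eqI) (simp add: coeff_map_poly)
  have mult: "map_poly cnj (u * v) = map_poly cnj u * map_poly cnj v" for u v
    by (intro poly_eqI) (simp add: coeff_map_poly coeff_mult)
  show ?case
    using pCons by (simp add: pcompose_pCons add mult map_poly_pCons)
qed

lemma T_op_complex: "map_poly complex_of_real (T_op \<theta> h P) = T_complex \<theta> h P"
proof -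
  let ?p = "map_poly complex_of_real P"
  have p: "map_poly cnj ?p = ?p"
    by (intro poly_eqI) (simp add: coeff_map_poly)
  have c: "cnj (coeff (pcompose ?p [:\<i> * of_real h, 1:]) k)
      = coeff (pcompose ?p [:- \<i> * of_real h, 1:]) k" for k
    using map_poly_cnj_pcompose[of ?p "[:\<i> * of_real h, 1:]"]
    by (simp add: p map_poly_pCons coeff_map_poly flip: coeff_map_poly[of cnj])
  have c': "cnj (coeff (pcompose ?p [:- \<i> * of_real h, 1:]) k)
      = coeff (pcompose ?p [:\<i> * of_real h, 1:]) k" for k
    using c[of k] by (metis complex_cnj_cnj)
  have "cnj (coeff (T_complex \<theta> h P) k) = coeff (T_complex \<theta> h P) k" for k
    unfolding T_complex_def coeff_smult coeff_diff complex_cnj_mult complex_cnj_diff c c'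
    by (simp add: exp_cnj field_simps)
  then show ?thesis
    by (intro poly_eqI) (simp add: T_op_def coeff_map_poly complex_eq_iff)
qed

lemma poly_T_op:
  "complex_of_real (poly (T_op \<theta> h P) x) =
     (exp (\<i> * of_real \<theta>) * poly (map_poly of_real P) (of_real x + \<i> * of_real h)
      - exp (- \<i> * of_real \<theta>) * poly (map_poly of_real P) (of_real x - \<i> * of_real h)) / \<i>"
proof -
  have "complex_of_real (poly R y) = poly (map_poly of_real R) (of_real y)" for R y
    by (induction R) (simp_all add: map_poly_pCons)
  then show ?thesis
    by (simp add: T_op_complex T_complex_def poly_pcompose algebra_simps)
qed

lemma poly_Q_poly:
  "complex_of_real (poly (Q_poly n \<theta>) x) =
     (exp (\<i> * of_real \<theta>) * (of_real x + \<i>) ^ n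
      - exp (- \<i> * of_real \<theta>) * (of_real x - \<i>) ^ n) / \<i>"
  by (simp add: Q_poly_def poly_T_op map_poly_monom poly_monom)

end

theory Submission
  imports Defs "HOL-Computational_Algebra.Fundamental_Theorem_Algebra"
begin

text \<open>
  Let \<open>x\<close> be a root of \<open>T_op \<theta> h P\<close> and let \<open>b\<^sub>1, \<dots>, b\<^sub>n\<close> be the roots of \<open>P\<close>. With
  \<open>\<alpha>\<^sub>j = arctan ((x - b\<^sub>j) / h)\<close>, the number \<open>P (x + \<i>h)\<close> has argument
  \<open>\<Sum>\<^sub>j (\<pi>/2 - \<alpha>\<^sub>j)\<close> modulo \<open>\<pi>\<close>, so \<open>x\<close> being a root is a condition on \<open>\<theta>\<close> and the mean
  \<open>a\<close> of the \<open>\<alpha>\<^sub>j\<close> only. Hence \<open>y = tan a\<close> is a root of \<open>Q_poly n \<theta>\<close>, and since \<open>a\<close> lies between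
  the extremal \<open>\<alpha>\<^sub>j\<close>, \<open>(x - max b\<^sub>j) / h \<le> y \<le> (x - min b\<^sub>j) / h\<close>.
\<close>

lemma of_real_poly: "complex_of_real (poly R x) = poly (map_poly of_real R) (of_real x)"
  by (induction R) (simp_all add: map_poly_pCons)

lemma poly_T_op_complex:
  "poly (map_poly complex_of_real (T_op \<theta> h P)) z =
     (exp (\<i> * of_real \<theta>) * poly (map_poly of_real P) (z + \<i> * of_real h)
      - exp (- \<i> * of_real \<theta>) * poly (map_poly of_real P) (z - \<i> * of_real h)) / \<i>"
  by (simp add: T_op_complex T_complex_def poly_pcompose algebra_simps)

text \<open>Over the complex numbers \<open>P\<close> splits into linear factors, and hyperbolicity
  makes every root equal to its real part. A multiset keeps the multiplicities, so its size is the
  full degree.\<close>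

lemma hyperbolic_roots:
  assumes "hyperbolic P" "P \<noteq> 0"
  obtains B where "size B = degree P" "\<And>b. b \<in># B \<Longrightarrow> poly P b = 0"
    "\<And>z. poly (map_poly complex_of_real P) z
      = of_real (lead_coeff P) * (\<Prod>b\<in>#B. z - of_real b)"
proof -
  let ?p = "map_poly complex_of_real P"
  have p0: "?p \<noteq> 0" using assms by (simp add: map_poly_eq_0_iff)
  obtain A where A: "size A = degree ?p" "?p = smult (lead_coeff ?p) (\<Prod>x\<in>#A. [:-x, 1:])"
    using alg_closed_imp_factorization[OF p0] by blast
  have ev: "poly ?p z = lead_coeff ?p * (\<Prod>x\<in>#A. z - x)" for z
    by (subst A(2)) (simp add: poly_prod_mset image_mset.compositionality o_def)
  have root: "poly ?p a = 0" if "a \<in># A" for a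
    unfolding ev using that by (auto simp: prod_mset_zero_iff)
  have real: "complex_of_real (Re a) = a" if "a \<in># A" for a
    using root[OF that] assms unfolding hyperbolic_def by (simp add: of_real_Re)
  show thesis
  proof (rule that[of "image_mset Re A"])
    show "size (image_mset Re A) = degree P" using A(1) by (simp add: degree_map_poly)
    show "poly P b = 0" if b: "b \<in># image_mset Re A" for b
    proof -
      from b obtain a where a: "a \<in># A" "b = Re a" by auto
      have "complex_of_real (poly P b) = 0"
        unfolding of_real_poly using root[OF a(1)] real[OF a(1)] a(2) by simp
      then show ?thesis by simp
    qed
    show "poly ?p z = of_real (lead_coeff P) * (\<Prod>b\<in>#image_mset Re A. z - of_real b)" for z
    proof -
      have "image_mset (\<lambda>x. z - x) A = image_mset (\<lambda>x. z - of_real (Re x)) A"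
        by (rule image_mset_cong) (simp add: real)
      then show ?thesis
        by (simp add: ev image_mset.compositionality o_def degree_map_poly coeff_map_poly)
    qed
  qed
qed

lemma add_ii_polar: "complex_of_real u + \<i> = of_real (sqrt (1 + u\<^sup>2)) * cis (pi/2 - arctan u)"
  by (simp add: complex_eq_iff cos_diff sin_diff sin_arctan cos_arctan)
    (metis real_sqrt_eq_zero_cancel_iff sum_power2_eq_zero_iff power_one zero_neq_one)

text \<open>Each factor equals h times ((x - b)/h + i), whose argument \<open>add_ii_polar\<close>
  supplies, and arguments add up. Only the argument matters for the zeros, so the modulus is hidden
  in some nonzero \<open>r\<close>.\<close>

lemma prod_mset_polar:
  assumes "h > 0"
  shows "\<exists>r. r \<noteq> 0 \<and> (\<Prod>b\<in>#B. complex_of_real x + \<i> * of_real h - of_real b)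
    = of_real r * cis (\<Sum>b\<in>#B. pi/2 - arctan ((x - b) / h))"
proof (induction B)
  case empty
  then show ?case by (intro exI[of _ 1]) simp
next
  case (add b B)
  then obtain r where r: "r \<noteq> 0" "(\<Prod>b\<in>#B. complex_of_real x + \<i> * of_real h - of_real b)
    = of_real r * cis (\<Sum>b\<in>#B. pi/2 - arctan ((x - b) / h))" by blast
  let ?u = "(x - b) / h"
  have "complex_of_real x + \<i> * of_real h - of_real b = of_real h * (of_real ?u + \<i>)"
    using assms by (simp add: field_simps)
  also have "\<dots> = of_real (h * sqrt (1 + ?u\<^sup>2)) * cis (pi/2 - arctan ?u)"
    by (simp only: add_ii_polar of_real_mult mult.assoc)
  finally have "(\<Prod>b\<in>#add_mset b B. complex_of_real x + \<i> * of_real h - of_real b)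
    = of_real (h * sqrt (1 + ?u\<^sup>2) * r) * cis (\<Sum>b\<in>#add_mset b B. pi/2 - arctan ((x - b) / h))"
    by (simp add: r cis_mult[symmetric])
  moreover have "sqrt (1 + ?u\<^sup>2) \<noteq> 0"
    by (metis real_sqrt_eq_zero_cancel_iff sum_power2_eq_zero_iff power_one zero_neq_one)
  ultimately show ?case
    using assms r(1) by (intro exI[of _ "h * sqrt (1 + ?u\<^sup>2) * r"]) simp
qed

text \<open>The two terms are complex conjugates, so their difference is 2i times an imaginary part.
  Used for both \<open>T_op\<close> and \<open>Q_poly\<close>, it turns a zero of either into a zero
  of the same sine.\<close>

lemma exp_cis_diff:
  "exp (\<i> * of_real \<theta>) * (of_real r * cis t) - exp (- \<i> * of_real \<theta>) * (of_real r * cis (- t))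
   = 2 * \<i> * of_real (r * sin (\<theta> + t))"
proof -
  have "exp (\<i> * of_real \<theta>) = cis \<theta>" "exp (- \<i> * of_real \<theta>) = cis (- \<theta>)"
    by (simp_all add: cis_conv_exp)
  then show ?thesis
    by (simp add: complex_eq_iff sin_add algebra_simps)
qed

lemma sum_mset_mono_const:
  fixes f :: "'a \<Rightarrow> real"
  assumes "\<And>b. b \<in># B \<Longrightarrow> l \<le> f b" "\<And>b. b \<in># B \<Longrightarrow> f b \<le> u"
  shows "real (size B) * l \<le> (\<Sum>b\<in>#B. f b) \<and> (\<Sum>b\<in>#B. f b) \<le> real (size B) * u"
  using assms by (induction B) (fastforce simp: algebra_simps)+

lemma T_op_root_imp_Q_poly_root:
  assumes P: "hyperbolic P" "degree P = n" "n \<ge> 1" and h: "h > 0"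
    and x: "poly (T_op \<theta> h P) x = 0"
  obtains y where "poly (Q_poly n \<theta>) y = 0"
    "Min {x. poly P x = 0} + h * y \<le> x" "x \<le> Max {x. poly P x = 0} + h * y"
proof -
  let ?m = "Min {x. poly P x = 0}" and ?M = "Max {x. poly P x = 0}"
  have P0: "P \<noteq> 0" using P by auto
  obtain B where B: "size B = degree P" "\<And>b. b \<in># B \<Longrightarrow> poly P b = 0"
    "\<And>z. poly (map_poly complex_of_real P) z
      = of_real (lead_coeff P) * (\<Prod>b\<in>#B. z - of_real b)"
    using hyperbolic_roots[OF P(1) P0] by metis
  have fin: "finite {x. poly P x = 0}" using P0 by (rule poly_roots_finite)
  define s where "s = (\<Sum>b\<in>#B. arctan ((x - b) / h))"
  define a where "a = s / n"
  have n: "real n > 0" using P(3) by simp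
  have "real (size B) * arctan ((x - ?M) / h) \<le> s \<and> s \<le> real (size B) * arctan ((x - ?m) / h)"
    unfolding s_def
  proof (rule sum_mset_mono_const)
    fix b assume "b \<in># B"
    then have "b \<in> {x. poly P x = 0}" using B(2) by simp
    then have "?m \<le> b" "b \<le> ?M" using fin by auto
    then show "arctan ((x - ?M) / h) \<le> arctan ((x - b) / h)"
      "arctan ((x - b) / h) \<le> arctan ((x - ?m) / h)"
      using h by (simp_all add: divide_right_mono arctan_le_iff)
  qed
  then have a: "arctan ((x - ?M) / h) \<le> a" "a \<le> arctan ((x - ?m) / h)"
    using n B(1) P(2) by (simp_all add: a_def field_simps)
  \<comment> \<open>Lying between two values of arctan, \<open>a\<close> is in the open interval
    from -pi/2 to pi/2, where arctan inverts tan.\<close>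
  have a_tan: "arctan (tan a) = a"
    using a arctan_bounded[of "(x - ?M) / h"] arctan_bounded[of "(x - ?m) / h"]
    by (intro arctan_tan) linarith+
  have sum: "(\<Sum>b\<in>#B. pi/2 - arctan ((x - b) / h)) = n * (pi/2 - a)"
  proof -
    have "(\<Sum>b\<in>#C. pi/2 - arctan ((x - b) / h))
        = size C * (pi/2) - (\<Sum>b\<in>#C. arctan ((x - b) / h))" for C
      by (induction C) (auto simp: algebra_simps add_divide_distrib)
    then show ?thesis using n B(1) P(2) by (simp add: a_def s_def algebra_simps)
  qed
  obtain r where r: "r \<noteq> 0" "(\<Prod>b\<in>#B. complex_of_real x + \<i> * of_real h - of_real b)
    = of_real r * cis (n * (pi/2 - a))"
    using prod_mset_polar[OF h, of x B] sum by auto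
  have "poly (map_poly complex_of_real P) (of_real x + \<i> * of_real h)
      = of_real (lead_coeff P * r) * cis (n * (pi/2 - a))"
    unfolding B(3) r(2) by simp
  moreover have "poly (map_poly complex_of_real P) (of_real x - \<i> * of_real h)
      = cnj (poly (map_poly complex_of_real P) (of_real x + \<i> * of_real h))"
  proof -
    have "(\<Prod>b\<in>#C. complex_of_real x - \<i> * of_real h - of_real b)
        = cnj (\<Prod>b\<in>#C. complex_of_real x + \<i> * of_real h - of_real b)" for C
      by (induction C) simp_all
    then show ?thesis unfolding B(3) by simp
  qed
  ultimately have "complex_of_real (poly (T_op \<theta> h P) x)
      = 2 * of_real (lead_coeff P * r * sin (\<theta> + n * (pi/2 - a)))"
    unfolding poly_T_op using exp_cis_diff[of \<theta> "lead_coeff P * r" "n * (pi/2 - a)"]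
    by (simp add: cis_cnj)
  \<comment> \<open>The factor \<open>lead_coeff P * r\<close> is nonzero, so the root condition
    constrains the angle alone.\<close>
  then have sin0: "sin (\<theta> + n * (pi/2 - a)) = 0"
    using x r(1) P0 by simp
  define q where "q = sqrt (1 + (tan a)\<^sup>2)"
  \<comment> \<open>By \<open>a_tan\<close>, the number tan a + i has argument pi/2 - a, so its n-th
    power has exactly the angle that occurs in \<open>sin0\<close>.\<close>
  have pl: "(of_real (tan a) + \<i>) ^ n = of_real (q ^ n) * cis (n * (pi/2 - a))"
    unfolding add_ii_polar a_tan q_def by (simp only: power_mult_distrib Complex.DeMoivre of_real_power)
  have "(of_real (tan a) - \<i>) ^ n = cnj ((of_real (tan a) + \<i>) ^ n)" by simp
  also have "\<dots> = of_real (q ^ n) * cis (- (n * (pi/2 - a)))"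
    unfolding pl by (simp add: cis_cnj)
  finally have "complex_of_real (poly (Q_poly n \<theta>) (tan a)) = 0"
    unfolding poly_Q_poly pl using exp_cis_diff[of \<theta> "q ^ n" "n * (pi/2 - a)"] sin0
    by simp
  then have "poly (Q_poly n \<theta>) (tan a) = 0" by simp
  moreover have "(x - ?M) / h \<le> tan a" "tan a \<le> (x - ?m) / h"
    using a a_tan by (metis arctan_le_iff)+
  ultimately show thesis using h by (intro that[of "tan a"]) (simp_all add: field_simps)
qed

lemma norm_prod_mset_less:
  fixes u v :: complex
  assumes "B \<noteq> {#}" "\<And>b :: real. norm (u - of_real b) < norm (v - of_real b)"
  shows "norm (\<Prod>b\<in>#B. u - of_real b) < norm (\<Prod>b\<in>#B. v - of_real b)"
  using assms(1)
proof (induction B)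
  case (add b B)
  show ?case
  proof (cases "B = {#}")
    case False
    then show ?thesis using add assms(2)[of b]
      by (simp add: norm_mult mult_strict_mono')
  qed (use assms(2) in simp)
qed simp

text \<open>Both points have the same horizontal distance from the real number \<open>b\<close>, so
  the comparison is between |Im z - h| and |Im z + h|.\<close>

lemma norm_shift_less:
  assumes "h > 0" "Im z > 0"
  shows "norm (z - \<i> * of_real h - of_real b) < norm (z + \<i> * of_real h - of_real b)"
proof -
  have "(Im z - h)\<^sup>2 < (Im z + h)\<^sup>2"
    using mult_pos_pos[OF assms] by (simp add: power2_eq_square algebra_simps)
  then show ?thesis by (simp add: cmod_def)
qed

text \<open>Off the real axis the two terms of \<open>T_op\<close> have different absolute values.\<close>

lemma hyperbolic_T_op:
  assumes P: "hyperbolic P" "degree P \<ge> 1" and h: "h > 0"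
  shows "hyperbolic (T_op \<theta> h P)"
  unfolding hyperbolic_def
proof (intro disjI2 allI impI)
  fix z assume z: "poly (map_poly complex_of_real (T_op \<theta> h P)) z = 0"
  let ?p = "poly (map_poly complex_of_real P)"
  have P0: "P \<noteq> 0" using P by auto
  obtain B where B: "size B = degree P"
    "\<And>z. ?p z = of_real (lead_coeff P) * (\<Prod>b\<in>#B. z - of_real b)"
    using hyperbolic_roots[OF P(1) P0] by metis
  have B0: "B \<noteq> {#}" using B(1) P(2) by auto
  have "exp (\<i> * of_real \<theta>) * ?p (z + \<i> * of_real h)
      = exp (- \<i> * of_real \<theta>) * ?p (z - \<i> * of_real h)"
    using z unfolding poly_T_op_complex by simp
  \<comment> \<open>The exponentials have modulus 1 and the leading coefficient cancels.\<close>
  from arg_cong[OF this, of norm]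
  have eq: "norm (\<Prod>b\<in>#B. z + \<i> * of_real h - of_real b)
      = norm (\<Prod>b\<in>#B. z - \<i> * of_real h - of_real b)"
    using P0 by (simp add: norm_mult B(2) norm_exp_eq_Re)
  have "\<not> Im z > 0"
    using norm_prod_mset_less[OF B0 norm_shift_less[OF h]] eq by fastforce
  moreover have "\<not> Im z < 0"
  proof
    assume "Im z < 0"
    \<comment> \<open>The reflection sending z to -z and b to -b reduces the lower half-plane to the
      upper one.\<close>
    have "norm (z + \<i> * of_real h - of_real b) < norm (z - \<i> * of_real h - of_real b)" for b
      using norm_shift_less[OF h, of "- z" "- b"] \<open>Im z < 0\<close>
      by (simp add: norm_minus_commute algebra_simps)
    from norm_prod_mset_less[OF B0 this] eq show False by simp
  qed
  ultimately show "z \<in> \<real>" by (simp add: complex_is_Real_iff)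
qed

lemma hyperbolic_has_root:
  assumes "hyperbolic R" "degree R \<noteq> 0"
  shows "\<exists>x. poly R x = 0"
proof -
  have "R \<noteq> 0" using assms(2) by auto
  then obtain B where "size B = degree R" "\<And>b. b \<in># B \<Longrightarrow> poly R b = 0"
    using hyperbolic_roots[OF assms(1)] by metis
  with assms(2) show ?thesis by (metis size_eq_0_iff_empty multiset_nonemptyE)
qed

text \<open>At the point i the term with (z - i)^n vanishes, while the other one is a nonzero
  multiple of (2i)^n.\<close>

lemma Q_poly_neq_0:
  assumes "n \<ge> 1"
  shows "Q_poly n \<theta> \<noteq> 0"
proof
  assume "Q_poly n \<theta> = 0"
  then have "poly (map_poly complex_of_real (T_op \<theta> 1 (monom 1 n))) \<i> = 0"
    by (simp add: Q_poly_def)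
  then show False
    using assms unfolding poly_T_op_complex by (simp add: map_poly_monom poly_monom power_0_left)
qed

theorem theorem1p5:
  fixes P :: "real poly" and n :: nat and \<theta> h :: real
  assumes "hyperbolic P" and "degree P = n" and "n \<ge> 1" and "h > 0"
  shows "max_root (T_op \<theta> h P) \<le> max_root P + ereal h * max_root (Q_poly n \<theta>) \<and>
         min_root (T_op \<theta> h P) \<ge> min_root P + ereal h * min_root (Q_poly n \<theta>)"
proof (cases "degree (T_op \<theta> h P) = 0")
  \<comment> \<open>Here the maximal root is -\<infinity> and the minimal root \<infinity>, so both
    bounds hold whatever the right-hand sides are.\<close>
  case True
  then show ?thesis by (simp add: max_root_def min_root_def)
next
  case False
  let ?T = "T_op \<theta> h P" and ?Q = "Q_poly n \<theta>"
  define Z where "Z R = {x :: real. poly R x = 0}" for R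
  have Q0: "?Q \<noteq> 0" using assms(3) by (rule Q_poly_neq_0)
  have finT: "finite (Z ?T)" unfolding Z_def using False by (intro poly_roots_finite) auto
  have finQ: "finite (Z ?Q)" unfolding Z_def using Q0 by (rule poly_roots_finite)
  have "hyperbolic ?T" using assms by (intro hyperbolic_T_op) auto
  then have neT: "Z ?T \<noteq> {}" using hyperbolic_has_root[OF _ False] by (auto simp: Z_def)
  have key: "\<exists>y \<in> Z ?Q. Min (Z P) + h * y \<le> x \<and> x \<le> Max (Z P) + h * y" if "x \<in> Z ?T" for x
    using T_op_root_imp_Q_poly_root[OF assms] that unfolding Z_def by blast
  \<comment> \<open>It suffices to apply \<open>key\<close> at the two extremal roots and to replace
    the resulting root of \<open>?Q\<close> by its largest or smallest one, which is sound because h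
    > 0.\<close>
  have "Max (Z ?T) \<in> Z ?T" using finT neT by (rule Max_in)
  from key[OF this] obtain y where y: "y \<in> Z ?Q" "Max (Z ?T) \<le> Max (Z P) + h * y" by blast
  have "h * y \<le> h * Max (Z ?Q)" using assms(4) finQ y(1) by simp
  with y(2) have max: "Max (Z ?T) \<le> Max (Z P) + h * Max (Z ?Q)" by linarith
  have "Min (Z ?T) \<in> Z ?T" using finT neT by (rule Min_in)
  from key[OF this] obtain w where w: "w \<in> Z ?Q" "Min (Z P) + h * w \<le> Min (Z ?T)" by blast
  have "h * Min (Z ?Q) \<le> h * w" using assms(4) finQ w(1) by simp
  with w(2) have min: "Min (Z P) + h * Min (Z ?Q) \<le> Min (Z ?T)" by linarith
  \<comment> \<open>A nonzero polynomial with a root is not constant, so no infinite value occurs on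
    the right-hand sides and the bounds reduce to real inequalities.\<close>
  have "degree ?Q \<noteq> 0"
  proof
    assume "degree ?Q = 0"
    then obtain c where "?Q = [:c:]" by (rule degree_eq_zeroE)
    with y(1) Q0 show False by (simp add: Z_def)
  qed
  then show ?thesis
    using False assms max min by (simp add: max_root_def min_root_def Z_def)
qed

end
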